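(* Let $\langle A,\vee,\wedge,\sim,\nabla,1\rangle$ be a 4-valued modal algebra (${\rm M}_4$-algebra). Define $\triangle x=\sim\nabla\sim x$, $x\supset y=\sim x\vee y$, $x\to y=\nabla\sim x\vee y$, $x\mapsto y=(x\to y)\wedge(\nabla y\vee\sim x)$ and $x\succ y=(x\mapsto y)\wedge((x\supset y)\to(\triangle\sim x\vee y))$. Then, with $0=\sim 1$, $\langle A,\succ,1\rangle$ is a modal ${\rm G}_4^0$-algebra (${\rm MDG}_4^0$-algebra) with least element $0$, and for all $x,y\in A$: $x\vee y=(x\succ y)\succ y$, $\sim x=x\succ 0$, $\nabla x=\sim x\succ x$, and $x\wedge y=\sim(\sim x\vee\sim y)$.
   Context: A 4-valued modal algebra (${\rm M}_4$-algebra) is an algebra $\langle A,\wedge,\vee,\sim,\nabla,1\rangle$ of type $(2,2,1,1,0)$ such that $(A,\wedge,\vee)$ is a distributive lattice, $\sim\sim x=x$, $\sim(x\vee y)=\sim x\wedge\sim y$, $\nabla x\vee\sim x=1$ and $\nabla x\wedge\sim x=\sim x\wedge x$ for all $x,y$. A G-algebra is an algebra $\langle A,\succ,1\rangle$ of type $(2,0)$ satisfying for all $x,y,z$: (G1) $1\succ x=x$; (G2) $x\succ 1=1$; (G3) $(x\succ y)\succ y=(y\succ x)\succ x$; (G4) if $x\succ(y\succ z)=1$ then $y\succ(x\succ z)=1$. The relation $x\leq y$ iff $x\succ y=1$ is a partial order. A ${\rm G}^0$-algebra is a G-algebra with an element $0$ with $0\leq x$ for all $x$; put $x\vee' y=(x\succ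 y)\succ y$, $\sim' x=x\succ 0$, $x\wedge' y=\sim'(\sim' x\vee'\sim' y)$, $\nabla' x=\sim' x\succ x$. It is distributive if $(x\wedge' y)\succ z\leq(x\succ z)\vee'(y\succ z)$ for all $x,y,z$. A ${\rm G}_4^0$-algebra is a ${\rm G}^0$-algebra satisfying $((x\succ(x\succ y))\succ x)\succ x=1$. An ${\rm MDG}_4^0$-algebra is a distributive ${\rm G}_4^0$-algebra satisfying $\nabla' x\succ(\nabla' x\succ 0)=\nabla' x\succ 0$ for all $x$. *)

theory Defs
  imports Main
begin

text \<open>
  All algebras are carried by a set \<open>A\<close>; the operations are total functions on the ambient type of
  which only the values on \<open>A\<close> matter. Carriers are nonempty because they contain \<open>\<one>\<close>.
\<close>

locale distributive_lattice =
  fixes A :: "'a set"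
    and meet :: "'a \<Rightarrow> 'a \<Rightarrow> 'a" (infixl "\<sqinter>" 70)
    and join :: "'a \<Rightarrow> 'a \<Rightarrow> 'a" (infixl "\<squnion>" 65)
  assumes meet_closed: "\<lbrakk>x \<in> A; y \<in> A\<rbrakk> \<Longrightarrow> x \<sqinter> y \<in> A"
    and join_closed: "\<lbrakk>x \<in> A; y \<in> A\<rbrakk> \<Longrightarrow> x \<squnion> y \<in> A"
    and meet_assoc: "\<lbrakk>x \<in> A; y \<in> A; z \<in> A\<rbrakk> \<Longrightarrow> (x \<sqinter> y) \<sqinter> z = x \<sqinter> (y \<sqinter> z)"
    and join_assoc: "\<lbrakk>x \<in> A; y \<in> A; z \<in> A\<rbrakk> \<Longrightarrow> (x \<squnion> y) \<squnion> z = x \<squnion> (y \<squnion> z)"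
    and meet_commute: "\<lbrakk>x \<in> A; y \<in> A\<rbrakk> \<Longrightarrow> x \<sqinter> y = y \<sqinter> x"
    and join_commute: "\<lbrakk>x \<in> A; y \<in> A\<rbrakk> \<Longrightarrow> x \<squnion> y = y \<squnion> x"
    and meet_join_absorb: "\<lbrakk>x \<in> A; y \<in> A\<rbrakk> \<Longrightarrow> x \<sqinter> (x \<squnion> y) = x"
    and join_meet_absorb: "\<lbrakk>x \<in> A; y \<in> A\<rbrakk> \<Longrightarrow> x \<squnion> (x \<sqinter> y) = x"
    and meet_join_distrib:
      "\<lbrakk>x \<in> A; y \<in> A; z \<in> A\<rbrakk> \<Longrightarrow> x \<sqinter> (y \<squnion> z) = (x \<sqinter> y) \<squnion> (x \<sqinter> z)"

locale M4_algebra = distributive_lattice A meet join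
  for A :: "'a set"
    and meet :: "'a \<Rightarrow> 'a \<Rightarrow> 'a" (infixl "\<sqinter>" 70)
    and join :: "'a \<Rightarrow> 'a \<Rightarrow> 'a" (infixl "\<squnion>" 65) +
  fixes neg :: "'a \<Rightarrow> 'a" ("\<sim> _" [81] 80)
    and nabla :: "'a \<Rightarrow> 'a" ("\<nabla> _" [81] 80)
    and one :: 'a ("\<one>")
  assumes neg_closed: "x \<in> A \<Longrightarrow> \<sim> x \<in> A"
    and nabla_closed: "x \<in> A \<Longrightarrow> \<nabla> x \<in> A"
    and one_closed: "\<one> \<in> A"
    and neg_neg: "x \<in> A \<Longrightarrow> \<sim> (\<sim> x) = x"
    and neg_join: "\<lbrakk>x \<in> A; y \<in> A\<rbrakk> \<Longrightarrow> \<sim> (x \<squnion> y) = (\<sim> x) \<sqinter> (\<sim> y)"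
    and nabla_join_neg: "x \<in> A \<Longrightarrow> (\<nabla> x) \<squnion> (\<sim> x) = \<one>"
    and nabla_meet_neg: "x \<in> A \<Longrightarrow> (\<nabla> x) \<sqinter> (\<sim> x) = (\<sim> x) \<sqinter> x"
begin

definition triangle :: "'a \<Rightarrow> 'a" ("\<triangle> _" [81] 80)
  where "\<triangle> x = \<sim> (\<nabla> (\<sim> x))"

definition mimp :: "'a \<Rightarrow> 'a \<Rightarrow> 'a" (infixr "\<supset>\<^sub>M" 60)
  where "x \<supset>\<^sub>M y = (\<sim> x) \<squnion> y"

definition wimp :: "'a \<Rightarrow> 'a \<Rightarrow> 'a" (infixr "\<rightarrow>\<^sub>M" 60)
  where "x \<rightarrow>\<^sub>M y = (\<nabla> (\<sim> x)) \<squnion> y"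

definition cimp :: "'a \<Rightarrow> 'a \<Rightarrow> 'a" (infixr "\<mapsto>\<^sub>M" 60)
  where "x \<mapsto>\<^sub>M y = (x \<rightarrow>\<^sub>M y) \<sqinter> ((\<nabla> y) \<squnion> (\<sim> x))"

definition gimp :: "'a \<Rightarrow> 'a \<Rightarrow> 'a" (infixr "\<succ>\<^sub>M" 60)
  where "x \<succ>\<^sub>M y = (x \<mapsto>\<^sub>M y) \<sqinter> ((x \<supset>\<^sub>M y) \<rightarrow>\<^sub>M ((\<triangle> (\<sim> x)) \<squnion> y))"

end

locale G_algebra =
  fixes A :: "'a set"
    and succ :: "'a \<Rightarrow> 'a \<Rightarrow> 'a" (infixr "\<succ>" 60)
    and one :: 'a ("\<one>")
  assumes succ_closed: "\<lbrakk>x \<in> A; y \<in> A\<rbrakk> \<Longrightarrow> x \<succ> y \<in> A"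
    and one_closed: "\<one> \<in> A"
    and G1: "x \<in> A \<Longrightarrow> \<one> \<succ> x = x"
    and G2: "x \<in> A \<Longrightarrow> x \<succ> \<one> = \<one>"
    and G3: "\<lbrakk>x \<in> A; y \<in> A\<rbrakk> \<Longrightarrow> (x \<succ> y) \<succ> y = (y \<succ> x) \<succ> x"
    and G4: "\<lbrakk>x \<in> A; y \<in> A; z \<in> A; x \<succ> (y \<succ> z) = \<one>\<rbrakk> \<Longrightarrow> y \<succ> (x \<succ> z) = \<one>"
begin

definition le :: "'a \<Rightarrow> 'a \<Rightarrow> bool" (infix "\<preceq>" 50)
  where "x \<preceq> y \<longleftrightarrow> x \<succ> y = \<one>"

end

locale G0_algebra = G_algebra A succ one
  for A :: "'a set"
    and succ :: "'a \<Rightarrow> 'a \<Rightarrow> 'a" (infixr "\<succ>" 60)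
    and one :: 'a ("\<one>") +
  fixes zero :: 'a ("\<zero>")
  assumes zero_closed: "\<zero> \<in> A"
    and zero_least: "x \<in> A \<Longrightarrow> \<zero> \<preceq> x"
begin

definition gjoin :: "'a \<Rightarrow> 'a \<Rightarrow> 'a" (infixl "\<squnion>\<^sub>G" 65)
  where "x \<squnion>\<^sub>G y = (x \<succ> y) \<succ> y"

definition gneg :: "'a \<Rightarrow> 'a" ("\<sim>\<^sub>G _" [81] 80)
  where "\<sim>\<^sub>G x = x \<succ> \<zero>"

definition gmeet :: "'a \<Rightarrow> 'a \<Rightarrow> 'a" (infixl "\<sqinter>\<^sub>G" 70)
  where "x \<sqinter>\<^sub>G y = \<sim>\<^sub>G ((\<sim>\<^sub>G x) \<squnion>\<^sub>G (\<sim>\<^sub>G y))"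

definition gnabla :: "'a \<Rightarrow> 'a" ("\<nabla>\<^sub>G _" [81] 80)
  where "\<nabla>\<^sub>G x = (\<sim>\<^sub>G x) \<succ> x"

end

locale distributive_G0_algebra = G0_algebra A succ one zero
  for A :: "'a set"
    and succ :: "'a \<Rightarrow> 'a \<Rightarrow> 'a" (infixr "\<succ>" 60)
    and one :: 'a ("\<one>")
    and zero :: 'a ("\<zero>") +
  assumes distributive:
    "\<lbrakk>x \<in> A; y \<in> A; z \<in> A\<rbrakk> \<Longrightarrow> ((x \<sqinter>\<^sub>G y) \<succ> z) \<preceq> ((x \<succ> z) \<squnion>\<^sub>G (y \<succ> z))"

locale G40_algebra = G0_algebra A succ one zero
  for A :: "'a set"
    and succ :: "'a \<Rightarrow> 'a \<Rightarrow> 'a" (infixr "\<succ>" 60)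
    and one :: 'a ("\<one>")
    and zero :: 'a ("\<zero>") +
  assumes four_valued:
    "\<lbrakk>x \<in> A; y \<in> A\<rbrakk> \<Longrightarrow> ((x \<succ> (x \<succ> y)) \<succ> x) \<succ> x = \<one>"

locale MDG40_algebra =
  distributive_G0_algebra A succ one zero + G40_algebra A succ one zero
  for A :: "'a set"
    and succ :: "'a \<Rightarrow> 'a \<Rightarrow> 'a" (infixr "\<succ>" 60)
    and one :: 'a ("\<one>")
    and zero :: 'a ("\<zero>") +
  assumes modal:
    "x \<in> A \<Longrightarrow> (\<nabla>\<^sub>G x) \<succ> ((\<nabla>\<^sub>G x) \<succ> \<zero>) = (\<nabla>\<^sub>G x) \<succ> \<zero>"

end

theory Submission
  imports Defs
begin

text \<open>
  Distinct elements of a distributive lattice are separated by a prime filter \<open>P\<close>. In an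
  \<open>M\<^sub>4\<close>-algebra the truth values of \<open>x \<in> P\<close> and \<open>\<sim> x \<in> P\<close> determine those of
  \<open>\<nabla> x \<in> P\<close> and \<open>\<sim> \<nabla> x \<in> P\<close>, so \<open>P\<close> yields a homomorphism onto a
  subalgebra of the four-element \<open>M\<^sub>4\<close>-algebra. Every identity, and likewise the quasi-identity
  (G4), thereby becomes a propositional tautology in these truth values.
\<close>

section \<open>Prime filters in a distributive lattice\<close>

context distributive_lattice
begin

text \<open>The equivalence combines closure under meets with upward closure; the improper filter
  \<open>A\<close> is allowed.\<close>

definition lattice_filter :: "'a set \<Rightarrow> bool"
  where "lattice_filter F \<longleftrightarrow> F \<subseteq> A \<and> F \<noteq> {} \<and>
    (\<forall>x\<in>A. \<forall>y\<in>A. x \<sqinter> y \<in> F \<longleftrightarrow> x \<in> F \<and> y \<in> F)"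

definition prime_filter :: "'a set \<Rightarrow> bool"
  where "prime_filter P \<longleftrightarrow> lattice_filter P \<and> P \<noteq> A \<and>
    (\<forall>x\<in>A. \<forall>y\<in>A. x \<squnion> y \<in> P \<longleftrightarrow> x \<in> P \<or> y \<in> P)"

lemma meet_idem: "x \<in> A \<Longrightarrow> x \<sqinter> x = x"
  by (metis join_meet_absorb meet_closed meet_join_absorb)

lemma meet_left_commute:
  "\<lbrakk>x \<in> A; y \<in> A; z \<in> A\<rbrakk> \<Longrightarrow> x \<sqinter> (y \<sqinter> z) = y \<sqinter> (x \<sqinter> z)"
  by (metis meet_assoc meet_commute)

lemmas meet_ac = meet_assoc meet_commute meet_left_commute

lemma principal_filter:
  assumes a: "a \<in> A"
  shows "lattice_filter {x \<in> A. a \<sqinter> x = a}"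
proof -
  have "a \<sqinter> (x \<sqinter> y) = a \<longleftrightarrow> a \<sqinter> x = a \<and> a \<sqinter> y = a"
    if "x \<in> A" "y \<in> A" for x y
    using that a by (metis meet_assoc meet_closed meet_commute meet_idem)
  with a show ?thesis
    by (auto simp: lattice_filter_def meet_closed intro: meet_idem)
qed

lemma filter_upward:
  assumes "lattice_filter F" "x \<in> F" "y \<in> A" "x \<sqinter> y = x"
  shows "y \<in> F"
  using assms unfolding lattice_filter_def by (metis subsetD)

text \<open>\<open>G\<close> is the filter generated by \<open>F\<close> and \<open>x\<close>:
  everything above some \<open>m \<sqinter> x\<close> with \<open>m\<close> in
  \<open>F\<close>.\<close>

lemma filter_adjoin:
  assumes F: "lattice_filter F" and x: "x \<in> A"
  defines "G \<equiv> {z \<in> A. \<exists>m\<in>F. (m \<sqinter> x) \<sqinter> z = m \<sqinter> x}"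
  shows "lattice_filter G" "F \<subseteq> G" "x \<in> G"
proof -
  have FA: "F \<subseteq> A" and Fne: "F \<noteq> {}"
    using F by (auto simp: lattice_filter_def)
  have absorb: "(m \<sqinter> x) \<sqinter> m = m \<sqinter> x" "(m \<sqinter> x) \<sqinter> x = m \<sqinter> x" if "m \<in> A" for m
    using that x by (metis meet_assoc meet_commute meet_idem)+
  show FG: "F \<subseteq> G"
    using FA absorb(1) unfolding G_def by auto
  show "x \<in> G"
    using FA Fne absorb(2) x unfolding G_def by auto
  have "z \<sqinter> w \<in> G \<longleftrightarrow> z \<in> G \<and> w \<in> G" if zw: "z \<in> A" "w \<in> A" for z w
  proof
    assume "z \<sqinter> w \<in> G"
    then obtain m where m: "m \<in> F" "(m \<sqinter> x) \<sqinter> (z \<sqinter> w) = m \<sqinter> x"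
      by (auto simp: G_def)
    then have "m \<sqinter> x \<in> A" using FA x meet_closed by auto
    with m zw have "(m \<sqinter> x) \<sqinter> z = m \<sqinter> x" "(m \<sqinter> x) \<sqinter> w = m \<sqinter> x"
      by (metis meet_assoc meet_closed meet_commute meet_idem)+
    with m zw show "z \<in> G \<and> w \<in> G" by (auto simp: G_def)
  next
    assume "z \<in> G \<and> w \<in> G"
    then obtain m n where mn: "m \<in> F" "n \<in> F"
      and e: "(m \<sqinter> x) \<sqinter> z = m \<sqinter> x" "(n \<sqinter> x) \<sqinter> w = n \<sqinter> x"
      by (auto simp: G_def)
    have mnA: "m \<in> A" "n \<in> A" using mn FA by auto
    \<comment> \<open>The witness for \<open>z \<sqinter> w\<close> is
      \<open>m \<sqinter> n\<close>.\<close>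
    have "((m \<sqinter> n) \<sqinter> x) \<sqinter> (z \<sqinter> w) = ((m \<sqinter> x) \<sqinter> z) \<sqinter> ((n \<sqinter> x) \<sqinter> w)"
      using mnA zw x by (metis meet_ac(1,3) meet_closed meet_idem)
    also have "\<dots> = (m \<sqinter> n) \<sqinter> x"
      unfolding e using mnA x by (metis meet_ac(1,3) meet_closed meet_idem)
    finally have "((m \<sqinter> n) \<sqinter> x) \<sqinter> (z \<sqinter> w) = (m \<sqinter> n) \<sqinter> x" .
    moreover have "m \<sqinter> n \<in> F" using F mn mnA by (auto simp: lattice_filter_def)
    ultimately show "z \<sqinter> w \<in> G" using zw by (auto simp: G_def meet_closed)
  qed
  moreover have "G \<noteq> {}" using FG Fne by auto
  ultimately show "lattice_filter G"
    by (auto simp: lattice_filter_def G_def)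
qed

text \<open>Zorn's lemma gives a filter maximal among those that contain \<open>a\<close> and avoid
  \<open>b\<close>; distributivity makes it prime.\<close>

theorem prime_filter_separation:
  assumes a: "a \<in> A" and b: "b \<in> A" and ab: "a \<sqinter> b \<noteq> a"
  shows "\<exists>P. prime_filter P \<and> a \<in> P \<and> b \<notin> P"
proof -
  let ?\<F> = "{F. lattice_filter F \<and> a \<in> F \<and> b \<notin> F}"
  have "\<exists>M\<in>?\<F>. \<forall>X\<in>?\<F>. M \<subseteq> X \<longrightarrow> X = M"
  proof (rule subset_Zorn_nonempty)
    \<comment> \<open>The principal filter of \<open>a\<close> avoids \<open>b\<close> because
      \<open>a \<sqinter> b \<noteq> a\<close>.\<close>
    show "?\<F> \<noteq> {}"
      using principal_filter[OF a] a b ab meet_idem by blast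
  next
    fix \<C> assume ne: "\<C> \<noteq> {}" and chain: "subset.chain ?\<F> \<C>"
    have CF: "lattice_filter F" "a \<in> F" "b \<notin> F" if "F \<in> \<C>" for F
      using chain that by (auto simp: subset_chain_def)
    have tot: "F \<subseteq> G \<or> G \<subseteq> F" if "F \<in> \<C>" "G \<in> \<C>" for F G
      using chain that by (auto simp: subset_chain_def)
    have "x \<sqinter> y \<in> \<Union>\<C> \<longleftrightarrow> x \<in> \<Union>\<C> \<and> y \<in> \<Union>\<C>" if "x \<in> A" "y \<in> A" for x y
    proof
      assume "x \<sqinter> y \<in> \<Union>\<C>"
      then show "x \<in> \<Union>\<C> \<and> y \<in> \<Union>\<C>"
        using CF(1) that unfolding lattice_filter_def by blast
    next
      assume "x \<in> \<Union>\<C> \<and> y \<in> \<Union>\<C>"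
      then obtain F G where "F \<in> \<C>" "G \<in> \<C>" "x \<in> F" "y \<in> G" by blast
      then obtain H where "H \<in> \<C>" "x \<in> H" "y \<in> H" using tot by blast
      then show "x \<sqinter> y \<in> \<Union>\<C>"
        using CF(1) that unfolding lattice_filter_def by blast
    qed
    moreover have "\<Union>\<C> \<subseteq> A" "\<Union>\<C> \<noteq> {}"
      using CF ne unfolding lattice_filter_def by blast+
    ultimately have "lattice_filter (\<Union>\<C>)" by (simp add: lattice_filter_def)
    with CF ne show "\<Union>\<C> \<in> ?\<F>" by blast
  qed
  then obtain M where M: "lattice_filter M" "a \<in> M" "b \<notin> M"
    and max: "\<And>X. \<lbrakk>lattice_filter X; a \<in> X; b \<notin> X; M \<subseteq> X\<rbrakk> \<Longrightarrow> X = M"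
    by blast
  have MA: "M \<subseteq> A" using M(1) by (simp add: lattice_filter_def)
  \<comment> \<open>By maximality, adjoining \<open>x\<close> to \<open>M\<close> must bring in
    \<open>b\<close>.\<close>
  have extend: "\<exists>m\<in>M. (m \<sqinter> x) \<sqinter> b = m \<sqinter> x" if "x \<in> A" "x \<notin> M" for x
    using filter_adjoin[OF M(1) that(1)] max M(2) that(2) by blast
  have "x \<squnion> y \<in> M \<longleftrightarrow> x \<in> M \<or> y \<in> M" if xy: "x \<in> A" "y \<in> A" for x y
  proof
    assume xyM: "x \<squnion> y \<in> M"
    show "x \<in> M \<or> y \<in> M"
    proof (rule ccontr)
      assume "\<not> (x \<in> M \<or> y \<in> M)"
      then obtain m n where mn: "m \<in> M" "n \<in> M"
        and e: "(m \<sqinter> x) \<sqinter> b = m \<sqinter> x" "(n \<sqinter> y) \<sqinter> b = n \<sqinter> y"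
        using extend xy by meson
      \<comment> \<open>A common \<open>k\<close> puts both \<open>k \<sqinter> x\<close> and
        \<open>k \<sqinter> y\<close> below \<open>b\<close>; by distributivity
        \<open>k \<sqinter> (x \<squnion> y)\<close>, an element of \<open>M\<close>, is below
        \<open>b\<close> too.\<close>
      define k where "k = m \<sqinter> n"
      have mnA: "m \<in> A" "n \<in> A" using mn MA by auto
      have k: "k \<in> M" "k \<in> A"
        using M(1) mn mnA MA by (auto simp: lattice_filter_def k_def)
      have kx: "b \<sqinter> (k \<sqinter> x) = k \<sqinter> x"
        unfolding k_def using e(1) mnA xy b by (metis meet_ac meet_closed)
      have ky: "b \<sqinter> (k \<sqinter> y) = k \<sqinter> y"
        unfolding k_def using e(2) mnA xy b by (metis meet_ac meet_closed)
      have "b \<sqinter> (k \<sqinter> (x \<squnion> y)) = k \<sqinter> (x \<squnion> y)"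
        using k xy b kx ky by (simp add: meet_join_distrib meet_closed)
      moreover have "k \<sqinter> (x \<squnion> y) \<in> M"
        using M(1) k xy xyM by (auto simp: lattice_filter_def join_closed)
      ultimately show False
        using M filter_upward b MA meet_commute by (metis subsetD)
    qed
  next
    assume "x \<in> M \<or> y \<in> M"
    then show "x \<squnion> y \<in> M"
      using M(1) xy filter_upward join_closed join_commute meet_join_absorb by metis
  qed
  with M b have "prime_filter M" by (auto simp: prime_filter_def)
  with M show ?thesis by blast
qed

lemma eq_if_prime_filters:
  assumes x: "x \<in> A" and y: "y \<in> A"
    and iff: "\<And>P. prime_filter P \<Longrightarrow> x \<in> P \<longleftrightarrow> y \<in> P"
  shows "x = y"
proof -
  have "x \<sqinter> y = x" using prime_filter_separation[OF x y] iff by blast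
  moreover have "y \<sqinter> x = y" using prime_filter_separation[OF y x] iff by blast
  ultimately show ?thesis using meet_commute[OF x y] by simp
qed

end

section \<open>Four-valued evaluation at a prime filter\<close>

context M4_algebra
begin

lemma neg_meet: "\<lbrakk>x \<in> A; y \<in> A\<rbrakk> \<Longrightarrow> \<sim> (x \<sqinter> y) = (\<sim> x) \<squnion> (\<sim> y)"
  by (metis join_closed neg_closed neg_join neg_neg)

text \<open>The first axiom for \<nabla>, taken at \<open>\<sim> x\<close>, writes
  \<open>\<one>\<close> as a join with \<open>x\<close>; absorption does the rest.\<close>

lemma meet_one: "x \<in> A \<Longrightarrow> x \<sqinter> \<one> = x"
  by (metis join_commute meet_join_absorb nabla_closed nabla_join_neg neg_closed neg_neg)

lemma prime_meet: "\<lbrakk>prime_filter P; x \<in> A; y \<in> A\<rbrakk> \<Longrightarrow> x \<sqinter> y \<in> P \<longleftrightarrow> x \<in> P \<and> y \<in> P"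
  by (simp add: prime_filter_def lattice_filter_def)

lemma prime_join: "\<lbrakk>prime_filter P; x \<in> A; y \<in> A\<rbrakk> \<Longrightarrow> x \<squnion> y \<in> P \<longleftrightarrow> x \<in> P \<or> y \<in> P"
  by (simp add: prime_filter_def)

lemma prime_one:
  assumes P: "prime_filter P"
  shows "\<one> \<in> P"
proof -
  obtain p where "p \<in> P" "p \<in> A"
    using P by (auto simp: prime_filter_def lattice_filter_def)
  then show ?thesis
    using prime_meet[OF P _ one_closed, of p] by (simp add: meet_one)
qed

text \<open>Dually to \<open>meet_one\<close>, \<open>\<sim> \<one>\<close> is the least element, so
  containing it would force \<open>P = A\<close>.\<close>

lemma prime_zero:
  assumes P: "prime_filter P"
  shows "\<sim> \<one> \<notin> P"
proof
  assume zero: "\<sim> \<one> \<in> P"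
  have "x \<in> P" if "x \<in> A" for x
  proof -
    have "\<sim> (\<sim> x \<sqinter> \<one>) = x"
      using that by (simp add: meet_one neg_closed neg_neg)
    then have "x \<squnion> \<sim> \<one> = x"
      using that by (simp add: neg_meet neg_closed one_closed neg_neg)
    then show ?thesis
      using prime_join[OF P that neg_closed[OF one_closed]] zero by simp
  qed
  with P show False by (auto simp: prime_filter_def lattice_filter_def)
qed

text \<open>The join axiom puts \<open>\<nabla> x\<close> in \<open>P\<close> whenever
  \<open>\<sim> x \<notin> P\<close>; otherwise the meet axiom reduces
  \<open>\<nabla> x \<in> P\<close> to \<open>x \<in> P\<close>.\<close>

lemma prime_nabla:
  assumes P: "prime_filter P" and x: "x \<in> A"
  shows "\<nabla> x \<in> P \<longleftrightarrow> x \<in> P \<or> \<sim> x \<notin> P"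
proof -
  have "\<nabla> x \<in> P \<or> \<sim> x \<in> P"
    using prime_join[OF P nabla_closed neg_closed, OF x x] prime_one[OF P] nabla_join_neg[OF x]
    by simp
  moreover have "\<nabla> x \<in> P \<and> \<sim> x \<in> P \<longleftrightarrow> \<sim> x \<in> P \<and> x \<in> P"
    using prime_meet[OF P nabla_closed neg_closed, OF x x] prime_meet[OF P neg_closed, OF x x]
      nabla_meet_neg[OF x]
    by simp
  ultimately show ?thesis by blast
qed

text \<open>The De Morgan duals of the two axioms for \<open>\<nabla>\<close> replace the usual involution on prime filters.\<close>

lemma prime_neg_nabla:
  assumes P: "prime_filter P" and x: "x \<in> A"
  shows "\<sim> (\<nabla> x) \<in> P \<longleftrightarrow> \<sim> x \<in> P \<and> x \<notin> P"
proof -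
  note closed = x nabla_closed[OF x] neg_closed[OF x] neg_closed[OF nabla_closed[OF x]]
  have "\<sim> (\<nabla> x) \<sqinter> x = \<sim> \<one>"
    using nabla_join_neg[OF x] neg_join[of "\<nabla> x" "\<sim> x"] closed by (simp add: neg_neg)
  then have "\<not> (\<sim> (\<nabla> x) \<in> P \<and> x \<in> P)"
    using prime_meet[OF P, of "\<sim> (\<nabla> x)" x] prime_zero[OF P] closed by simp
  moreover have "\<sim> (\<nabla> x) \<squnion> x = x \<squnion> \<sim> x"
    using nabla_meet_neg[OF x] neg_meet[of "\<nabla> x" "\<sim> x"] neg_meet[of "\<sim> x" x] closed
    by (simp add: neg_neg)
  then have "\<sim> (\<nabla> x) \<in> P \<or> x \<in> P \<longleftrightarrow> x \<in> P \<or> \<sim> x \<in> P"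
    using prime_join[OF P, of "\<sim> (\<nabla> x)" x] prime_join[OF P, of x "\<sim> x"] closed by simp
  ultimately show ?thesis by blast
qed

lemma gimp_closed: "\<lbrakk>x \<in> A; y \<in> A\<rbrakk> \<Longrightarrow> x \<succ>\<^sub>M y \<in> A"
  by (simp add: gimp_def cimp_def wimp_def mimp_def triangle_def
      meet_closed join_closed neg_closed nabla_closed)

lemmas closed = meet_closed join_closed neg_closed nabla_closed one_closed gimp_closed

lemmas prime_base = prime_meet prime_join prime_one prime_zero prime_nabla prime_neg_nabla
  neg_neg neg_meet neg_join closed

text \<open>Regard the pair (\<open>x \<in> P\<close>, \<open>\<sim> x \<in> P\<close>) as the value
  of \<open>x\<close> in the four-element algebra. The implication then has value 1 if the value of
  \<open>x\<close> is below that of \<open>y\<close>; otherwise it has the value of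
  \<open>\<sim> x\<close> if \<open>y\<close> has value 0, and that of \<open>y\<close> if
  not.\<close>

lemma prime_gimp:
  assumes "prime_filter P" "x \<in> A" "y \<in> A"
  shows "x \<succ>\<^sub>M y \<in> P \<longleftrightarrow> y \<in> P \<or> (if \<sim> y \<in> P then \<sim> x \<in> P else x \<notin> P)"
  using assms by (simp add: gimp_def cimp_def wimp_def mimp_def triangle_def prime_base) blast

text \<open>The second coordinate of the same truth table, required to evaluate nested
  implications.\<close>

lemma prime_neg_gimp:
  assumes "prime_filter P" "x \<in> A" "y \<in> A"
  shows "\<sim> (x \<succ>\<^sub>M y) \<in> P \<longleftrightarrow> \<sim> y \<in> P \<and> (if y \<in> P then \<sim> x \<notin> P else x \<in> P)"
  using assms by (simp add: gimp_def cimp_def wimp_def mimp_def triangle_def prime_base) blast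

lemmas prime_simps = prime_base prime_gimp prime_neg_gimp

section \<open>Recovering the operations and the order from the implication\<close>

lemma join_eq_gimp: "\<lbrakk>x \<in> A; y \<in> A\<rbrakk> \<Longrightarrow> (x \<succ>\<^sub>M y) \<succ>\<^sub>M y = x \<squnion> y"
  by (rule eq_if_prime_filters) (auto simp: prime_simps)

lemma neg_eq_gimp: "x \<in> A \<Longrightarrow> x \<succ>\<^sub>M \<sim> \<one> = \<sim> x"
  by (rule eq_if_prime_filters) (auto simp: prime_simps)

lemma nabla_eq_gimp: "x \<in> A \<Longrightarrow> \<sim> x \<succ>\<^sub>M x = \<nabla> x"
  by (rule eq_if_prime_filters) (auto simp: prime_simps)

text \<open>The condition compares four-valued values at each \<open>P\<close>: that of
  \<open>x\<close> must lie below that of \<open>y\<close>, which is exactly when the implication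
  has value 1.\<close>

lemma gimp_eq_one_iff:
  assumes xy: "x \<in> A" "y \<in> A"
  shows "x \<succ>\<^sub>M y = \<one> \<longleftrightarrow>
    (\<forall>P. prime_filter P \<longrightarrow> (x \<in> P \<longrightarrow> y \<in> P) \<and> (\<sim> y \<in> P \<longrightarrow> \<sim> x \<in> P))"
    (is "_ \<longleftrightarrow> ?R")
proof
  assume eq: "x \<succ>\<^sub>M y = \<one>"
  show ?R
  proof (intro allI impI)
    fix P assume P: "prime_filter P"
    have "x \<succ>\<^sub>M y \<in> P" "\<sim> (x \<succ>\<^sub>M y) \<notin> P"
      using P by (simp_all add: eq prime_one prime_zero)
    with P xy show "(x \<in> P \<longrightarrow> y \<in> P) \<and> (\<sim> y \<in> P \<longrightarrow> \<sim> x \<in> P)"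
      by (auto simp: prime_gimp prime_neg_gimp split: if_splits)
  qed
next
  assume ?R
  with xy show "x \<succ>\<^sub>M y = \<one>"
    by (intro eq_if_prime_filters) (auto simp: prime_simps)
qed

section \<open>The axioms of a modal G-algebra with least element\<close>

lemma gimp_G_algebra: "G_algebra A gimp \<one>"
proof
  fix x y z assume xyz: "x \<in> A" "y \<in> A" "z \<in> A"
    and eq: "x \<succ>\<^sub>M (y \<succ>\<^sub>M z) = \<one>"
  \<comment> \<open>Hypothesis and conclusion of (G4) are both conditions at each prime filter, and
    the implication between them already holds at every single one.\<close>
  from eq show "y \<succ>\<^sub>M (x \<succ>\<^sub>M z) = \<one>"
    using xyz by (simp add: gimp_eq_one_iff closed prime_gimp prime_neg_gimp) metis
\<comment> \<open>By \<open>join_eq_gimp\<close>, (G3) is commutativity of the join.\<close>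
qed (auto simp: join_eq_gimp join_commute gimp_eq_one_iff prime_simps
    intro!: eq_if_prime_filters split: if_splits)

lemma gimp_G0_algebra: "G0_algebra A gimp \<one> (\<sim> \<one>)"
proof -
  interpret G: G_algebra A gimp \<one> by (rule gimp_G_algebra)
  show ?thesis
    by unfold_locales (auto simp: closed G.le_def gimp_eq_one_iff neg_neg prime_one prime_zero)
qed

lemma gimp_MDG40_algebra: "MDG40_algebra A gimp \<one> (\<sim> \<one>)"
proof -
  interpret G: G0_algebra A gimp \<one> "\<sim> \<one>" by (rule gimp_G0_algebra)
  have meet: "G.gmeet x y = x \<sqinter> y" if "x \<in> A" "y \<in> A" for x y
    using that by (simp add: G.gmeet_def G.gneg_def G.gjoin_def
        neg_eq_gimp join_eq_gimp closed neg_join neg_neg)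
  have nabla: "G.gnabla x = \<nabla> x" if "x \<in> A" for x
    using that by (simp add: G.gnabla_def G.gneg_def neg_eq_gimp nabla_eq_gimp)
  show ?thesis
  proof
    fix x y z assume "x \<in> A" "y \<in> A" "z \<in> A"
    then show "G.le (G.gmeet x y \<succ>\<^sub>M z) (G.gjoin (x \<succ>\<^sub>M z) (y \<succ>\<^sub>M z))"
      by (auto simp: G.le_def G.gjoin_def meet join_eq_gimp gimp_eq_one_iff prime_simps)
  next
    fix x y assume "x \<in> A" "y \<in> A"
    \<comment> \<open>The two outer implications form a join, so the claim becomes \<open>(x
      \<succ>\<^sub>M (x \<succ>\<^sub>M y)) \<squnion> x = \<one>\<close>.\<close>
    then show "((x \<succ>\<^sub>M (x \<succ>\<^sub>M y)) \<succ>\<^sub>M x) \<succ>\<^sub>M x = \<one>"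
      by (auto simp: join_eq_gimp prime_simps intro!: eq_if_prime_filters)
  next
    fix x assume "x \<in> A"
    \<comment> \<open>Exactly one of \<open>\<nabla> x\<close> and
      \<open>\<sim> (\<nabla> x)\<close> lies in each \<open>P\<close>, so \<open>\<nabla> x\<close>
      takes only the values 0 and 1, where contraction holds.\<close>
    then show "G.gnabla x \<succ>\<^sub>M (G.gnabla x \<succ>\<^sub>M \<sim> \<one>) = G.gnabla x \<succ>\<^sub>M \<sim> \<one>"
      by (auto simp: nabla prime_simps intro!: eq_if_prime_filters split: if_splits)
  qed
qed

end

theorem theorem3p9:
  fixes A :: "'a set"
    and meet join :: "'a \<Rightarrow> 'a \<Rightarrow> 'a"
    and neg nabla :: "'a \<Rightarrow> 'a"
    and one :: 'a
    and succ :: "'a \<Rightarrow> 'a \<Rightarrow> 'a" (infixr "\<succ>" 60)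
  assumes "M4_algebra A meet join neg nabla one"
  defines "succ \<equiv> M4_algebra.gimp meet join neg nabla"
  shows "MDG40_algebra A succ one (neg one) \<and>
    (\<forall>x\<in>A. \<forall>y\<in>A.
      join x y = (x \<succ> y) \<succ> y \<and>
      neg x = x \<succ> neg one \<and>
      nabla x = neg x \<succ> x \<and>
      meet x y = neg (join (neg x) (neg y)))"
proof -
  interpret M4_algebra A meet join neg nabla one by fact
  show ?thesis
    unfolding succ_def
    by (simp add: gimp_MDG40_algebra join_eq_gimp neg_eq_gimp nabla_eq_gimp
        neg_join neg_neg neg_closed)
qed

end
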